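(* The degree map on weighted dual skeletons is constant on isomorphism classes and multiplicative under the Cartesian product, and hence induces a group homomorphism $$\overline{\deg}:K_0(\mathsf{SDS})\longrightarrow\mathbb R_{>0}$$ from the Grothendieck group of the monoidal category $(\mathsf{SDS},\times,\mathcal I)$ to the multiplicative group of positive reals. This homomorphism is surjective.
   Context: A weighted dual skeleton is a triple $\mathcal E=(Z,\sigma,\kappa)$ where $Z$ is a non-empty finite set, $\sigma:Z\to Z$ satisfies $\sigma^2=\mathrm{id}$, and $\kappa:Z\to\mathbb R_{>0}$ satisfies $\kappa(z)\kappa(\sigma(z))=K$ for all $z\in Z$, with $K>0$ constant; $K=\deg(\mathcal E)$ is the degree. A morphism $\phi:(Z_1,\sigma_1,\kappa_1)\to(Z_2,\sigma_2,\kappa_2)$ is a map $\phi:Z_1\to Z_2$ with $\phi(\sigma_1(z))=\sigma_2(\phi(z))$ and $\kappa_1(z)=\kappa_2(\phi(z))$ for all $z\in Z_1$; $\mathsf{SDS}$ is the resulting category. Two skeletons are isomorphic if there is a bijective morphism between them. The Cartesian product is $\mathcal E_1\times\mathcal E_2=(Z_1\times Z_2,\sigma_1\times\sigma_2,\kappa_1\otimes\kappa_2)$ with $(\sigma_1\times\sigma_2)(z,w)=(\sigma_1(z),\sigma_2(w))$ and $(\kappa_1\otimes\kappa_2)(z,w)=\kappa_1(z)\kappa_2(w)$; the unit $\mathcal I$ is the skeleton with a single site with weight $1$. The Grothendieck group $K_0(\mathsf{SDS})$ is the abelian group generated by the isomorphism classes $[\mathcal E]$ of objects of $\mathsf{SDS}$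 subject to the relations $[\mathcal E_1]+[\mathcal E_2]=[\mathcal E_1\times\mathcal E_2]$, with formal inverses (i.e. the group completion of the commutative monoid of isomorphism classes under $\times$). The homomorphism $\overline{\deg}$ sends $[\mathcal E]$ to $\deg(\mathcal E)$. *)

theory Defs
  imports Complex_Main "HOL-Algebra.Free_Abelian_Groups"
begin

section \<open>Weighted dual skeletons\<close>

record 'a skeleton =
  sites :: "'a set"
  dual :: "'a \<Rightarrow> 'a"
  weight :: "'a \<Rightarrow> real"

definition is_degree :: "'a skeleton \<Rightarrow> real \<Rightarrow> bool" where
  "is_degree E K \<longleftrightarrow> K > 0 \<and> (\<forall>z\<in>sites E. weight E z * weight E (dual E z) = K)"

text \<open>Only the values of \<open>dual\<close> and \<open>weight\<close> on the sites matter; off the sites they are junk,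
  and morphisms ignore them.\<close>

definition weighted_dual_skeleton :: "'a skeleton \<Rightarrow> bool" where
  "weighted_dual_skeleton E \<longleftrightarrow>
     finite (sites E) \<and> sites E \<noteq> {} \<and>
     dual E \<in> sites E \<rightarrow> sites E \<and>
     (\<forall>z\<in>sites E. dual E (dual E z) = z) \<and>
     (\<forall>z\<in>sites E. weight E z > 0) \<and>
     (\<exists>K. is_degree E K)"

definition skel_deg :: "'a skeleton \<Rightarrow> real" where
  "skel_deg E = (THE K. is_degree E K)"

definition skel_morphism :: "'a skeleton \<Rightarrow> 'b skeleton \<Rightarrow> ('a \<Rightarrow> 'b) \<Rightarrow> bool" where
  "skel_morphism E1 E2 f \<longleftrightarrow>
     f \<in> sites E1 \<rightarrow> sites E2 \<and>
     (\<forall>z\<in>sites E1. f (dual E1 z) = dual E2 (f z)) \<and>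
     (\<forall>z\<in>sites E1. weight E1 z = weight E2 (f z))"

definition skel_isomorphic :: "'a skeleton \<Rightarrow> 'b skeleton \<Rightarrow> bool" where
  "skel_isomorphic E1 E2 \<longleftrightarrow> (\<exists>f. skel_morphism E1 E2 f \<and> bij_betw f (sites E1) (sites E2))"

definition skel_prod :: "'a skeleton \<Rightarrow> 'b skeleton \<Rightarrow> ('a \<times> 'b) skeleton" where
  "skel_prod E1 E2 =
     \<lparr>sites = sites E1 \<times> sites E2,
      dual = (\<lambda>(z, w). (dual E1 z, dual E2 w)),
      weight = (\<lambda>(z, w). weight E1 z * weight E2 w)\<rparr>"

definition skel_unit :: "unit skeleton" where
  "skel_unit = \<lparr>sites = {()}, dual = (\<lambda>z. z), weight = (\<lambda>_. 1)\<rparr>"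


section \<open>The Grothendieck group\<close>

text \<open>Every skeleton, over whatever type of sites, is isomorphic to one whose sites are natural
  numbers (lemma \<open>skeleton_nat_copy\<close> below). The isomorphism class of a skeleton is therefore
  represented by the set of all skeletons on natural numbers that are isomorphic to it; two skeletons
  have the same class iff they are isomorphic (lemma \<open>iso_class_eq_iff\<close>). This makes the
  class of a product meaningful even though its sites live in a product type.\<close>

definition iso_class :: "'a skeleton \<Rightarrow> nat skeleton set" where
  "iso_class E = {F. weighted_dual_skeleton F \<and> skel_isomorphic F E}"

definition iso_classes :: "nat skeleton set set" where
  "iso_classes = {iso_class E |E::nat skeleton. weighted_dual_skeleton E}"

definition K0_relators :: "(nat skeleton set \<Rightarrow>\<^sub>0 int) set" where
  "K0_relators =
     {frag_of (iso_class E1) + frag_of (iso_class E2) - frag_of (iso_class (skel_prod E1 E2))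
      |(E1::nat skeleton) (E2::nat skeleton). weighted_dual_skeleton E1 \<and> weighted_dual_skeleton E2}"

definition K0_relations :: "(nat skeleton set \<Rightarrow>\<^sub>0 int) set" where
  "K0_relations = generate (free_Abelian_group iso_classes) K0_relators"

definition K0_SDS :: "(nat skeleton set \<Rightarrow>\<^sub>0 int) set monoid" where
  "K0_SDS = free_Abelian_group iso_classes Mod K0_relations"

definition K0_class :: "'a skeleton \<Rightarrow> (nat skeleton set \<Rightarrow>\<^sub>0 int) set" where
  "K0_class E = K0_relations #>\<^bsub>free_Abelian_group iso_classes\<^esub> frag_of (iso_class E)"

definition pos_reals :: "real monoid" where
  "pos_reals = \<lparr>carrier = {0<..}, monoid.mult = (*), one = 1\<rparr>"


section \<open>Basic facts\<close>

lemma is_degree_skel_deg: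
  assumes "weighted_dual_skeleton E" shows "is_degree E (skel_deg E)"
proof -
  obtain K z where K: "is_degree E K" and z: "z \<in> sites E"
    using assms unfolding weighted_dual_skeleton_def by blast
  have "K' = K" if "is_degree E K'" for K'
    using K that z unfolding is_degree_def by metis
  with K have "\<exists>!K. is_degree E K" by blast
  then show ?thesis unfolding skel_deg_def by (rule theI')
qed

lemma skel_morphism_id: "skel_morphism E E (\<lambda>z. z)"
  by (auto simp: skel_morphism_def)

lemma skel_morphism_comp:
  "skel_morphism E1 E2 f \<Longrightarrow> skel_morphism E2 E3 g \<Longrightarrow> skel_morphism E1 E3 (g \<circ> f)"
  by (auto simp: skel_morphism_def Pi_iff)

lemma skel_morphism_prod:
  "skel_morphism E1 F1 f \<Longrightarrow> skel_morphism E2 F2 g \<Longrightarrow>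
   skel_morphism (skel_prod E1 E2) (skel_prod F1 F2) (map_prod f g)"
  by (auto simp: skel_morphism_def skel_prod_def Pi_iff)

lemma skel_isomorphic_refl: "skel_isomorphic E E"
  unfolding skel_isomorphic_def using skel_morphism_id bij_betw_id[unfolded id_def] by blast

lemma skel_isomorphic_trans:
  "skel_isomorphic E1 E2 \<Longrightarrow> skel_isomorphic E2 E3 \<Longrightarrow> skel_isomorphic E1 E3"
  unfolding skel_isomorphic_def using skel_morphism_comp bij_betw_trans by blast

lemma skel_isomorphic_sym:
  assumes "weighted_dual_skeleton E1" "skel_isomorphic E1 E2"
  shows "skel_isomorphic E2 E1"
proof -
  obtain f where f: "skel_morphism E1 E2 f" and b: "bij_betw f (sites E1) (sites E2)"
    using assms(2) unfolding skel_isomorphic_def by blast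
  let ?g = "inv_into (sites E1) f"
  have g: "?g w \<in> sites E1" "f (?g w) = w" if "w \<in> sites E2" for w
    using b that by (auto simp: bij_betw_def intro: inv_into_into f_inv_into_f)
  have gf: "?g (f z) = z" if "z \<in> sites E1" for z
    using b that by (simp add: bij_betw_def)
  have d: "dual E1 z \<in> sites E1" if "z \<in> sites E1" for z
    using assms(1) that by (auto simp: weighted_dual_skeleton_def)
  have "skel_morphism E2 E1 ?g"
    unfolding skel_morphism_def
  proof (intro conjI ballI)
    show "?g \<in> sites E2 \<rightarrow> sites E1" using g by blast
    fix w assume w: "w \<in> sites E2"
    have "dual E2 w = f (dual E1 (?g w))"
      using f g[OF w] by (auto simp: skel_morphism_def)
    then show "?g (dual E2 w) = dual E1 (?g w)" using gf d g[OF w] by simp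
    show "weight E2 w = weight E1 (?g w)"
      using f g[OF w] by (auto simp: skel_morphism_def)
  qed
  moreover have "bij_betw ?g (sites E2) (sites E1)" using b by (rule bij_betw_inv_into)
  ultimately show ?thesis unfolding skel_isomorphic_def by blast
qed

lemma weighted_dual_skeleton_prod:
  assumes "weighted_dual_skeleton E1" "weighted_dual_skeleton E2"
  shows "weighted_dual_skeleton (skel_prod E1 E2)"
proof -
  obtain K1 K2 where K: "is_degree E1 K1" "is_degree E2 K2"
    using assms unfolding weighted_dual_skeleton_def by blast
  have eq: "(weight E1 z * weight E2 w) * (weight E1 (dual E1 z) * weight E2 (dual E2 w)) = K1 * K2"
    if "z \<in> sites E1" "w \<in> sites E2" for z w
  proof -
    have "weight E1 z * weight E1 (dual E1 z) = K1" "weight E2 w * weight E2 (dual E2 w) = K2"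
      using K that by (auto simp: is_degree_def)
    then show ?thesis by (metis mult.assoc mult.left_commute)
  qed
  have "is_degree (skel_prod E1 E2) (K1 * K2)"
    using K eq by (auto simp: is_degree_def skel_prod_def)
  then have "\<exists>K. is_degree (skel_prod E1 E2) K" by blast
  then show ?thesis
    using assms by (auto simp: weighted_dual_skeleton_def skel_prod_def)
qed

lemma skel_isomorphic_prod:
  "skel_isomorphic E1 F1 \<Longrightarrow> skel_isomorphic E2 F2 \<Longrightarrow>
   skel_isomorphic (skel_prod E1 E2) (skel_prod F1 F2)"
  unfolding skel_isomorphic_def
proof (elim exE conjE)
  fix f g
  assume "skel_morphism E1 F1 f" "bij_betw f (sites E1) (sites F1)"
    and "skel_morphism E2 F2 g" "bij_betw g (sites E2) (sites F2)"
  then have "skel_morphism (skel_prod E1 E2) (skel_prod F1 F2) (map_prod f g)"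
    "bij_betw (map_prod f g) (sites (skel_prod E1 E2)) (sites (skel_prod F1 F2))"
    by (simp_all add: skel_morphism_prod bij_betw_map_prod skel_prod_def[THEN arg_cong[of _ _ sites]])
  then show "\<exists>h. skel_morphism (skel_prod E1 E2) (skel_prod F1 F2) h \<and>
      bij_betw h (sites (skel_prod E1 E2)) (sites (skel_prod F1 F2))" by blast
qed

lemma weighted_dual_skeleton_unit: "weighted_dual_skeleton skel_unit"
  by (auto simp: weighted_dual_skeleton_def skel_unit_def is_degree_def)

lemma skel_prod_unit_left: "skel_isomorphic (skel_prod skel_unit E) E"
  unfolding skel_isomorphic_def
  by (rule exI[of _ snd])
    (auto simp: skel_morphism_def skel_prod_def skel_unit_def bij_betw_def inj_on_def)

lemma skel_prod_unit_right: "skel_isomorphic (skel_prod E skel_unit) E"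
  unfolding skel_isomorphic_def
  by (rule exI[of _ fst])
    (auto simp: skel_morphism_def skel_prod_def skel_unit_def bij_betw_def inj_on_def)

lemma skel_prod_commute: "skel_isomorphic (skel_prod E1 E2) (skel_prod E2 E1)"
  unfolding skel_isomorphic_def
  by (rule exI[of _ prod.swap])
    (auto simp: skel_morphism_def skel_prod_def bij_betw_def inj_on_def)

lemma skel_prod_assoc:
  "skel_isomorphic (skel_prod (skel_prod E1 E2) E3) (skel_prod E1 (skel_prod E2 E3))"
  unfolding skel_isomorphic_def
  by (rule exI[of _ "\<lambda>((a, b), c). (a, b, c)"])
    (auto simp: skel_morphism_def skel_prod_def bij_betw_def inj_on_def image_iff)

lemma skeleton_nat_copy:
  assumes E: "weighted_dual_skeleton (E :: 'a skeleton)"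
  shows "\<exists>F::nat skeleton. weighted_dual_skeleton F \<and> skel_isomorphic F E"
proof -
  have fin: "finite (sites E)" using E by (simp add: weighted_dual_skeleton_def)
  obtain g where b: "bij_betw g {0..<card (sites E)} (sites E)"
    using ex_bij_betw_nat_finite[OF fin] by blast
  let ?N = "{0..<card (sites E)}"
  let ?i = "inv_into ?N g"
  have gi: "g (?i z) = z" "?i z \<in> ?N" if "z \<in> sites E" for z
    using b that f_inv_into_f[of z g ?N] inv_into_into[of z g ?N] by (simp_all add: bij_betw_def)
  have ig: "?i (g n) = n" "g n \<in> sites E" if "n \<in> ?N" for n
    using b that by (auto simp: bij_betw_def)
  define F :: "nat skeleton" where
    "F = \<lparr>sites = ?N, dual = (\<lambda>n. ?i (dual E (g n))), weight = (\<lambda>n. weight E (g n))\<rparr>"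
  have d: "dual E z \<in> sites E" "dual E (dual E z) = z" "weight E z > 0" if "z \<in> sites E" for z
    using E that by (auto simp: weighted_dual_skeleton_def)
  obtain K where K: "is_degree E K" using E by (auto simp: weighted_dual_skeleton_def)
  have sF: "sites F = ?N" and dF: "dual F = (\<lambda>n. ?i (dual E (g n)))"
    and wF: "weight F = (\<lambda>n. weight E (g n))"
    by (simp_all add: F_def)
  have "is_degree F K"
    unfolding is_degree_def sF dF wF using K ig gi d by (simp add: is_degree_def)
  moreover have "finite ?N" "?N \<noteq> {}"
    using E by (auto simp: weighted_dual_skeleton_def card_gt_0_iff)
  ultimately have "weighted_dual_skeleton F"
    unfolding weighted_dual_skeleton_def sF dF wF using ig gi d by (simp add: Pi_iff) blast
  moreover have "skel_morphism F E g"
    unfolding skel_morphism_def sF dF wF using ig gi d by simp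
  ultimately show ?thesis
    unfolding skel_isomorphic_def using b by (metis sF)
qed

lemma iso_class_eq_iff:
  assumes "weighted_dual_skeleton (E1 :: 'a skeleton)" "weighted_dual_skeleton (E2 :: 'b skeleton)"
  shows "iso_class E1 = iso_class E2 \<longleftrightarrow> skel_isomorphic E1 E2"
proof
  assume eq: "iso_class E1 = iso_class E2"
  obtain F :: "nat skeleton" where F: "weighted_dual_skeleton F" "skel_isomorphic F E1"
    using skeleton_nat_copy[OF assms(1)] by blast
  then have "skel_isomorphic F E2" using eq by (auto simp: iso_class_def)
  then show "skel_isomorphic E1 E2"
    using skel_isomorphic_trans[OF skel_isomorphic_sym[OF F]] by blast
next
  assume iso: "skel_isomorphic E1 E2"
  have "skel_isomorphic F E1 \<longleftrightarrow> skel_isomorphic F E2" for F :: "nat skeleton"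
    using skel_isomorphic_trans[OF _ iso, of F]
      skel_isomorphic_trans[OF _ skel_isomorphic_sym[OF assms(1) iso], of F] by (rule iffI)
  then show "iso_class E1 = iso_class E2"
    unfolding iso_class_def by simp
qed

lemma iso_class_in_iso_classes:
  assumes "weighted_dual_skeleton (E :: 'a skeleton)"
  shows "iso_class E \<in> iso_classes"
proof -
  obtain F :: "nat skeleton" where F: "weighted_dual_skeleton F" "skel_isomorphic F E"
    using skeleton_nat_copy[OF assms] by blast
  then have "iso_class F = iso_class E" using iso_class_eq_iff[OF F(1) assms] by blast
  then show ?thesis using F(1) unfolding iso_classes_def by blast
qed

lemma K0_relators_subset: "K0_relators \<subseteq> carrier (free_Abelian_group iso_classes)"
proof
  fix x assume "x \<in> K0_relators"
  then obtain E1 E2 :: "nat skeleton"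
    where E: "weighted_dual_skeleton E1" "weighted_dual_skeleton E2"
      and x: "x = frag_of (iso_class E1) + frag_of (iso_class E2)
                  - frag_of (iso_class (skel_prod E1 E2))"
    unfolding K0_relators_def by blast
  have "iso_class E1 \<in> iso_classes" "iso_class E2 \<in> iso_classes"
    "iso_class (skel_prod E1 E2) \<in> iso_classes"
    using E by (simp_all add: iso_class_in_iso_classes weighted_dual_skeleton_prod)
  then have "Poly_Mapping.keys x \<subseteq> iso_classes"
    unfolding x using keys_diff[of "frag_of (iso_class E1) + frag_of (iso_class E2)"
        "frag_of (iso_class (skel_prod E1 E2))"]
      keys_add[of "frag_of (iso_class E1)" "frag_of (iso_class E2)"]
    by (auto simp: subset_iff)
  then show "x \<in> carrier (free_Abelian_group iso_classes)" by simp
qed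

lemma subgroup_K0_relations: "subgroup K0_relations (free_Abelian_group iso_classes)"
  unfolding K0_relations_def
  by (rule group.generate_is_subgroup[OF group_free_Abelian_group K0_relators_subset])

lemma comm_group_K0_SDS: "comm_group K0_SDS"
  unfolding K0_SDS_def
  by (rule comm_group.abelian_FactGroup[OF abelian_free_Abelian_group subgroup_K0_relations])

lemma comm_group_pos_reals: "comm_group pos_reals"
proof (rule comm_groupI)
  fix x assume x: "x \<in> carrier pos_reals"
  then show "\<exists>y\<in>carrier pos_reals. y \<otimes>\<^bsub>pos_reals\<^esub> x = \<one>\<^bsub>pos_reals\<^esub>"
    by (intro bexI[of _ "inverse x"]) (simp_all add: pos_reals_def)
qed (simp_all add: pos_reals_def)

end

theory Submission
  imports Defs
begin

text \<open>
  The degree can be read off at any single site, as the product of the weights of the site and of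
  its dual. A morphism commutes with the duals and keeps weights, so it carries a site with its
  dual to a site with its dual and preserves this product (\<open>skel_deg_morphism\<close>); in a
  Cartesian product the four weights at a pair of sites regroup into the two degrees
  (\<open>skel_deg_prod\<close>).

  Hence the degree is a function on isomorphism classes with values in an abelian group. It extends
  to the free abelian group on the classes, and multiplicativity says precisely that the
  extension is trivial on the relators \<open>[E1] + [E2] - [E1 \<times> E2]\<close>, so it descends to the
  quotient (\<open>K0_deg_hom\<close>). The descended map is unique because the classes of skeletons
  generate the quotient (\<open>K0_hom_eqI\<close>). Every
  \<open>K > 0\<close> is attained already on the class of an actual skeleton, a single self-dual site of
  weight \<open>sqrt K\<close> (\<open>skeleton_of_degree\<close>).
\<close>

section \<open>Degrees of skeletons\<close>

lemma skel_deg_eqI: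
  assumes "weighted_dual_skeleton E" "is_degree E K"
  shows "skel_deg E = K"
proof -
  obtain z where "z \<in> sites E"
    using assms(1) by (auto simp: weighted_dual_skeleton_def)
  then show ?thesis
    using assms(2) is_degree_skel_deg[OF assms(1)] unfolding is_degree_def by metis
qed

lemma skel_deg_pos: "weighted_dual_skeleton E \<Longrightarrow> skel_deg E > 0"
  using is_degree_skel_deg by (auto simp: is_degree_def)

text \<open>A morphism transports the weights at one site and at its dual, and these two weights
  determine the degree on both sides.\<close>

lemma skel_deg_morphism:
  assumes "weighted_dual_skeleton E1" "weighted_dual_skeleton E2" "skel_morphism E1 E2 f"
  shows "skel_deg E1 = skel_deg E2"
proof -
  obtain z where z: "z \<in> sites E1"
    using assms(1) by (auto simp: weighted_dual_skeleton_def)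
  then have dz: "dual E1 z \<in> sites E1"
    using assms(1) by (auto simp: weighted_dual_skeleton_def)
  have fz: "f z \<in> sites E2"
    using assms(3) z by (auto simp: skel_morphism_def)
  have "skel_deg E1 = weight E1 z * weight E1 (dual E1 z)"
    using is_degree_skel_deg[OF assms(1)] z by (simp add: is_degree_def)
  also have "\<dots> = weight E2 (f z) * weight E2 (dual E2 (f z))"
    using assms(3) z dz by (simp add: skel_morphism_def)
  also have "\<dots> = skel_deg E2"
    using is_degree_skel_deg[OF assms(2)] fz by (simp add: is_degree_def)
  finally show ?thesis .
qed

lemma skel_deg_isomorphic:
  assumes "weighted_dual_skeleton E1" "weighted_dual_skeleton E2" "skel_isomorphic E1 E2"
  shows "skel_deg E1 = skel_deg E2"
  using assms skel_deg_morphism unfolding skel_isomorphic_def by blast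

lemma skel_deg_prod:
  assumes "weighted_dual_skeleton E1" "weighted_dual_skeleton E2"
  shows "skel_deg (skel_prod E1 E2) = skel_deg E1 * skel_deg E2"
proof (rule skel_deg_eqI)
  show "weighted_dual_skeleton (skel_prod E1 E2)"
    using assms by (rule weighted_dual_skeleton_prod)
  have E1: "weight E1 z * weight E1 (dual E1 z) = skel_deg E1" if "z \<in> sites E1" for z
    using is_degree_skel_deg[OF assms(1)] that by (simp add: is_degree_def)
  have E2: "weight E2 w * weight E2 (dual E2 w) = skel_deg E2" if "w \<in> sites E2" for w
    using is_degree_skel_deg[OF assms(2)] that by (simp add: is_degree_def)
  have "(weight E1 z * weight E2 w) * (weight E1 (dual E1 z) * weight E2 (dual E2 w))
      = skel_deg E1 * skel_deg E2" if "z \<in> sites E1" "w \<in> sites E2" for z w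
    unfolding E1[OF that(1), symmetric] E2[OF that(2), symmetric] by (simp add: mult_ac)
  then show "is_degree (skel_prod E1 E2) (skel_deg E1 * skel_deg E2)"
    using skel_deg_pos[OF assms(1)] skel_deg_pos[OF assms(2)]
    by (auto simp: is_degree_def skel_prod_def)
qed

text \<open>The square root makes the weight times itself equal to \<open>K\<close>, as the dual of
  the only site is that site.\<close>

lemma skeleton_of_degree:
  assumes "K > 0"
  obtains E :: "nat skeleton" where "weighted_dual_skeleton E" "skel_deg E = K"
proof -
  define E :: "nat skeleton" where
    "E = \<lparr>sites = {0}, dual = (\<lambda>z. z), weight = (\<lambda>_. sqrt K)\<rparr>"
  have deg: "is_degree E K"
    using assms by (simp add: is_degree_def E_def)
  then have E: "weighted_dual_skeleton E"
    using assms by (auto simp: weighted_dual_skeleton_def E_def)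
  from that[OF E skel_deg_eqI[OF E deg]] show thesis .
qed

section \<open>The degree on the Grothendieck group\<close>

definition class_deg :: "nat skeleton set \<Rightarrow> real" where
  "class_deg C = skel_deg (SOME F. F \<in> C)"

text \<open>The skeleton may have sites of any type: its class contains a copy on the natural numbers,
  and all members of the class have its degree.\<close>

lemma class_deg_iso_class:
  assumes "weighted_dual_skeleton (E :: 'a skeleton)"
  shows "class_deg (iso_class E) = skel_deg E"
proof -
  have "\<exists>F. F \<in> iso_class E"
    using skeleton_nat_copy[OF assms] by (auto simp: iso_class_def)
  then have "(SOME F. F \<in> iso_class E) \<in> iso_class E"
    by (rule someI_ex)
  then have "weighted_dual_skeleton (SOME F. F \<in> iso_class E)"
    and "skel_isomorphic (SOME F. F \<in> iso_class E) E"
    by (auto simp: iso_class_def)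
  from skel_deg_isomorphic[OF this(1) assms this(2)] show ?thesis
    by (simp add: class_deg_def)
qed

lemma K0_relations_normal: "K0_relations \<lhd> free_Abelian_group iso_classes"
  by (rule comm_group.subgroup_imp_normal[OF abelian_free_Abelian_group subgroup_K0_relations])

lemma K0_class_closed:
  assumes "weighted_dual_skeleton E"
  shows "K0_class E \<in> carrier K0_SDS"
  using iso_class_in_iso_classes[OF assms]
  by (auto simp: K0_SDS_def K0_class_def FactGroup_def RCOSETS_def)

text \<open>The degree extends from the basis to the free abelian group. Multiplicativity puts the
  relators into the kernel of the extension; the kernel is a subgroup, so it contains all that they
  generate, and the extension factors through the quotient. Only classes occur in the statement,
  so that it serves skeletons over every type of sites.\<close>

lemma K0_deg_hom:
  obtains g where "group_hom K0_SDS pos_reals g"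
    and "\<And>C. C \<in> iso_classes \<Longrightarrow>
      g (K0_relations #>\<^bsub>free_Abelian_group iso_classes\<^esub> frag_of C) = class_deg C"
proof -
  let ?F = "free_Abelian_group iso_classes"
  interpret P: comm_group pos_reals by (rule comm_group_pos_reals)
  have "class_deg ` iso_classes \<subseteq> carrier pos_reals"
    by (auto simp: iso_classes_def class_deg_iso_class skel_deg_pos pos_reals_def)
  then obtain f where f: "f \<in> hom ?F pos_reals"
    and f_of: "\<And>C. C \<in> iso_classes \<Longrightarrow> f (frag_of C) = class_deg C"
    using P.free_Abelian_group_universal by blast
  interpret f: group_hom ?F pos_reals f
    by (simp add: group_hom_def group_hom_axioms_def f P.group_axioms)
  have "K0_relators \<subseteq> kernel ?F pos_reals f"
  proof
    fix x assume x: "x \<in> K0_relators"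
    then obtain E1 E2 :: "nat skeleton"
      where E: "weighted_dual_skeleton E1" "weighted_dual_skeleton E2"
        and x_eq: "x = frag_of (iso_class E1) + frag_of (iso_class E2)
                      - frag_of (iso_class (skel_prod E1 E2))"
      unfolding K0_relators_def by blast
    note E12 = weighted_dual_skeleton_prod[OF E]
    have xF: "x \<in> carrier ?F"
      using x K0_relators_subset by blast
    have mem: "frag_of (iso_class E1) \<in> carrier ?F" "frag_of (iso_class E2) \<in> carrier ?F"
      "frag_of (iso_class (skel_prod E1 E2)) \<in> carrier ?F"
      using iso_class_in_iso_classes E E12 by auto
    \<comment> \<open>Moving the negative term to the other side avoids inverses in the target.\<close>
    have "x \<otimes>\<^bsub>?F\<^esub> frag_of (iso_class (skel_prod E1 E2))
        = frag_of (iso_class E1) \<otimes>\<^bsub>?F\<^esub> frag_of (iso_class E2)"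
      by (simp add: x_eq)
    then have "f x \<otimes>\<^bsub>pos_reals\<^esub> f (frag_of (iso_class (skel_prod E1 E2)))
        = f (frag_of (iso_class E1)) \<otimes>\<^bsub>pos_reals\<^esub> f (frag_of (iso_class E2))"
      using f.hom_mult[OF xF mem(3)] f.hom_mult[OF mem(1,2)] by simp
    then have "f x * (skel_deg E1 * skel_deg E2) = skel_deg E1 * skel_deg E2"
      using E E12
      by (simp add: pos_reals_def f_of iso_class_in_iso_classes class_deg_iso_class skel_deg_prod)
    then have "f x = \<one>\<^bsub>pos_reals\<^esub>"
      using skel_deg_pos[OF E(1)] skel_deg_pos[OF E(2)] by (simp add: pos_reals_def)
    with xF show "x \<in> kernel ?F pos_reals f"
      by (simp add: kernel_def)
  qed
  then have "K0_relations \<subseteq> kernel ?F pos_reals f"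
    unfolding K0_relations_def
    by (rule group.generate_subgroup_incl[OF group_free_Abelian_group _ f.subgroup_kernel])
  from f.FactGroup_universal_kernel[OF K0_relations_normal this]
  obtain g where g: "g \<in> hom (?F Mod K0_relations) pos_reals"
    and g_eq: "\<And>x. x \<in> carrier ?F \<Longrightarrow> g (K0_relations #>\<^bsub>?F\<^esub> x) = f x"
    by blast
  show thesis
  proof
    show "group_hom K0_SDS pos_reals g"
      using g comm_group.axioms(2)[OF comm_group_K0_SDS] P.group_axioms
      by (simp add: group_hom_def group_hom_axioms_def K0_SDS_def)
    show "g (K0_relations #>\<^bsub>?F\<^esub> frag_of C) = class_deg C" if "C \<in> iso_classes" for C
      using that by (simp add: g_eq f_of)
  qed
qed

section \<open>Uniqueness and surjectivity\<close>

lemma free_Abelian_group_hom_eqI: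
  assumes "group_hom (free_Abelian_group S) H f" "group_hom (free_Abelian_group S) H g"
    and eq: "\<And>a. a \<in> S \<Longrightarrow> f (frag_of a) = g (frag_of a)"
    and "x \<in> carrier (free_Abelian_group S)"
  shows "f x = g x"
proof -
  interpret f: group_hom "free_Abelian_group S" H f by fact
  interpret g: group_hom "free_Abelian_group S" H g by fact
  show ?thesis
  proof (rule free_Abelian_group_induct[where P = "\<lambda>x. f x = g x"])
    show "Poly_Mapping.keys x \<subseteq> S" using assms(4) by simp
    show "f 0 = g 0" using f.hom_one g.hom_one by simp
    fix a b
    assume keys: "Poly_Mapping.keys a \<subseteq> S" "Poly_Mapping.keys b \<subseteq> S"
      and IH: "f a = g a" "f b = g b"
    have mem: "a \<in> carrier (free_Abelian_group S)" "b \<in> carrier (free_Abelian_group S)"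
      using keys by simp_all
    have diff: "a - b = a \<otimes>\<^bsub>free_Abelian_group S\<^esub> inv\<^bsub>free_Abelian_group S\<^esub> b"
      using keys by simp
    show "f (a - b) = g (a - b)"
      unfolding diff f.hom_mult[OF mem(1) f.G.inv_closed[OF mem(2)]]
        g.hom_mult[OF mem(1) f.G.inv_closed[OF mem(2)]] f.hom_inv[OF mem(2)] g.hom_inv[OF mem(2)]
      by (simp only: IH)
  qed (rule eq)
qed

text \<open>Composing with the projection onto the quotient reduces the uniqueness to that of
  homomorphisms out of the free abelian group.\<close>

lemma K0_hom_eqI:
  assumes g: "group_hom K0_SDS H g" and h: "group_hom K0_SDS H h"
    and eq: "\<And>E :: nat skeleton. weighted_dual_skeleton E \<Longrightarrow> g (K0_class E) = h (K0_class E)"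
    and x: "x \<in> carrier K0_SDS"
  shows "g x = h x"
proof -
  let ?F = "free_Abelian_group iso_classes"
  let ?p = "\<lambda>a. K0_relations #>\<^bsub>?F\<^esub> a"
  have p: "?p \<in> hom ?F K0_SDS"
    unfolding K0_SDS_def by (rule normal.r_coset_hom_Mod[OF K0_relations_normal])
  have comp: "group_hom ?F H (k \<circ> ?p)" if "group_hom K0_SDS H k" for k
    using that hom_compose[OF p, of k H] by (simp add: group_hom_def group_hom_axioms_def)
  obtain a where a: "a \<in> carrier ?F" "x = ?p a"
    using x by (auto simp: K0_SDS_def FactGroup_def RCOSETS_def)
  have "(g \<circ> ?p) a = (h \<circ> ?p) a"
  proof (rule free_Abelian_group_hom_eqI[OF comp[OF g] comp[OF h] _ a(1)])
    fix C assume "C \<in> iso_classes"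
    then obtain E :: "nat skeleton" where "weighted_dual_skeleton E" "C = iso_class E"
      by (auto simp: iso_classes_def)
    then show "(g \<circ> ?p) (frag_of C) = (h \<circ> ?p) (frag_of C)"
      using eq by (simp add: K0_class_def)
  qed
  then show ?thesis by (simp add: a(2))
qed

theorem mainTheorem12:
  shows "(\<forall>(E1 :: 'a skeleton) (E2 :: 'b skeleton).
            weighted_dual_skeleton E1 \<and> weighted_dual_skeleton E2 \<and> skel_isomorphic E1 E2
              \<longrightarrow> skel_deg E1 = skel_deg E2) \<and>
         (\<forall>(E1 :: 'a skeleton) (E2 :: 'b skeleton).
            weighted_dual_skeleton E1 \<and> weighted_dual_skeleton E2
              \<longrightarrow> skel_deg (skel_prod E1 E2) = skel_deg E1 * skel_deg E2) \<and>
         (\<exists>deg_bar.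
            group_hom K0_SDS pos_reals deg_bar \<and>
            (\<forall>E :: nat skeleton. weighted_dual_skeleton E \<longrightarrow> deg_bar (K0_class E) = skel_deg E) \<and>
            (\<forall>E :: 'a skeleton. weighted_dual_skeleton E \<longrightarrow> deg_bar (K0_class E) = skel_deg E) \<and>
            (\<forall>h. group_hom K0_SDS pos_reals h \<and>
                 (\<forall>E :: nat skeleton. weighted_dual_skeleton E \<longrightarrow> h (K0_class E) = skel_deg E)
                   \<longrightarrow> (\<forall>x \<in> carrier K0_SDS. h x = deg_bar x)) \<and>
            deg_bar ` carrier K0_SDS = carrier pos_reals)"
proof -
  obtain g where g: "group_hom K0_SDS pos_reals g"
    and g_frag: "\<And>C. C \<in> iso_classes \<Longrightarrow>
      g (K0_relations #>\<^bsub>free_Abelian_group iso_classes\<^esub> frag_of C) = class_deg C"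
    using K0_deg_hom by blast
  have g_nat: "g (K0_class E) = skel_deg E" if "weighted_dual_skeleton E" for E :: "nat skeleton"
    using that by (simp add: K0_class_def g_frag iso_class_in_iso_classes class_deg_iso_class)
  have g_any: "g (K0_class E) = skel_deg E" if "weighted_dual_skeleton E" for E :: "'a skeleton"
    using that by (simp add: K0_class_def g_frag iso_class_in_iso_classes class_deg_iso_class)
  have uniq: "h x = g x"
    if "group_hom K0_SDS pos_reals h"
      and "\<forall>E :: nat skeleton. weighted_dual_skeleton E \<longrightarrow> h (K0_class E) = skel_deg E"
      and "x \<in> carrier K0_SDS" for h x
    using K0_hom_eqI[OF that(1) g _ that(3)] that(2) g_nat by simp
  have "carrier pos_reals \<subseteq> g ` carrier K0_SDS"
  proof
    fix K assume "K \<in> carrier pos_reals"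
    then have "K > 0" by (simp add: pos_reals_def)
    then obtain E :: "nat skeleton" where E: "weighted_dual_skeleton E" "skel_deg E = K"
      by (rule skeleton_of_degree)
    then show "K \<in> g ` carrier K0_SDS"
      using K0_class_closed[OF E(1)] g_nat[OF E(1)] by force
  qed
  moreover have "g ` carrier K0_SDS \<subseteq> carrier pos_reals"
    using group_hom.hom_closed[OF g] by blast
  ultimately have surj: "g ` carrier K0_SDS = carrier pos_reals"
    by blast
  show ?thesis
    by (intro conjI exI[of _ g] allI impI ballI)
      (use skel_deg_isomorphic skel_deg_prod g g_nat g_any uniq surj in blast)+
qed

end
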